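(* For all integers $g\ge 3$ and $k\ge 1$, there exists a finite collection $\mathcal{B}$ of axis-aligned boxes in $\mathbb{R}^3$ whose intersection graph has girth at least $g$ and chromatic number at least $k$.
   Context: An axis-aligned box in $\mathbb{R}^3$ is a set of the form $[a_1,b_1]\times[a_2,b_2]\times[a_3,b_3]$ with real numbers $a_i\le b_i$. The intersection graph of a collection of sets is the simple graph whose vertices are the sets of the collection, two distinct sets being adjacent if and only if they have non-empty intersection. The girth of a graph is the length of its shortest cycle ($\infty$ if the graph has no cycle). *)

theory Defs
  imports "HOL-Analysis.Analysis" "HOL-Library.Extended_Nat"
begin

text \<open>A simple graph is a pair of a vertex set and a set of two-element edges.\<close>

type_synonym 'a graph = "'a set \<times> 'a set set"

abbreviation verts :: "'a graph \<Rightarrow> 'a set" where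
  "verts G \<equiv> fst G"

abbreviation edges :: "'a graph \<Rightarrow> 'a set set" where
  "edges G \<equiv> snd G"

definition intersection_graph :: "'a set set \<Rightarrow> 'a set graph" where
  "intersection_graph C =
     (C, {{A, B} | A B. A \<in> C \<and> B \<in> C \<and> A \<noteq> B \<and> A \<inter> B \<noteq> {}})"

text \<open>A cycle is given by the list of its pairwise distinct vertices in cyclic order, without
  repeating the first vertex at the end; its length is therefore the length of the list.\<close>

definition is_cycle :: "'a graph \<Rightarrow> 'a list \<Rightarrow> bool" where
  "is_cycle G p \<longleftrightarrow>
     3 \<le> length p \<and> distinct p \<and> set p \<subseteq> verts G \<and>
     (\<forall>i < length p. {p ! i, p ! (Suc i mod length p)} \<in> edges G)"

text \<open>The infimum of the empty set in \<^typ>\<open>enat\<close> is \<open>\<infinity>\<close>, so acyclic graphs have infinite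
  girth, and graphs without a finite proper colouring have infinite chromatic number.\<close>

definition girth :: "'a graph \<Rightarrow> enat" where
  "girth G = (INF p \<in> {p. is_cycle G p}. enat (length p))"

definition proper_colouring :: "'a graph \<Rightarrow> nat \<Rightarrow> ('a \<Rightarrow> nat) \<Rightarrow> bool" where
  "proper_colouring G n c \<longleftrightarrow>
     (\<forall>v \<in> verts G. c v < n) \<and>
     (\<forall>u \<in> verts G. \<forall>v \<in> verts G. {u, v} \<in> edges G \<longrightarrow> c u \<noteq> c v)"

definition chromatic_number :: "'a graph \<Rightarrow> enat" where
  "chromatic_number G = (INF n \<in> {n. \<exists>c. proper_colouring G n c}. enat n)"

definition axis_aligned_box :: "(real ^ 3) set \<Rightarrow> bool" where
  "axis_aligned_box B \<longleftrightarrow> (\<exists>a b. (\<forall>i. a $ i \<le> b $ i) \<and> B = cbox a b)"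

end

theory Submission
  imports Defs
begin

text \<open>Large girth is expressed by leaves: a set system is sparse if every small subfamily has a member
  meeting the others in at most one point.  Highly chromatic sparse uniform hypergraphs come from the
  partite amalgamation of Nesetril and Rodl.  The boxes come from the construction of Tutte
  (Descartes): for every edge of such a hypergraph take a copy of the previous graph and match it with
  the vertices of the edge.  Geometrically, hypergraph vertices are tall boxes standing along the
  diagonal of the first two coordinates, each copy lies in its own horizontal layer, and every box of
  a copy projects to a rectangle with a corner on the diagonal.  So it meets the diagonal only there,
  and hits just one tall box; since any strictly increasing relabelling of the corners preserves the
  intersections, a copy can be fitted to any edge.\<close>

section \<open>Sparse set systems\<close>

definition shared :: "('i \<Rightarrow> 'v set) \<Rightarrow> 'i set \<Rightarrow> 'i \<Rightarrow> 'v set" where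
  "shared e J i = e i \<inter> (\<Union>j\<in>J - {i}. e j)"

text \<open>Equivalent to the absence of hypergraph cycles through fewer than \<open>g\<close>
  members, where two members with two common points count as a cycle. The family is indexed, so a
  repeated set counts as two members.\<close>

definition sparse :: "nat \<Rightarrow> 'i set \<Rightarrow> ('i \<Rightarrow> 'v set) \<Rightarrow> bool" where
  "sparse g I e \<longleftrightarrow>
     (\<forall>J. J \<subseteq> I \<longrightarrow> finite J \<longrightarrow> J \<noteq> {} \<longrightarrow> card J < g \<longrightarrow> (\<exists>i\<in>J. \<exists>x. shared e J i \<subseteq> {x}))"

lemma sparseD:
  assumes "sparse g I e" "J \<subseteq> I" "finite J" "J \<noteq> {}" "card J < g"
  obtains i x where "i \<in> J" "shared e J i \<subseteq> {x}"
  using assms unfolding sparse_def by blast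

text \<open>The analogue of the fact that a tree has two leaves. Remove a leaf \<open>i\<close>,
  which meets the rest at most in \<open>x\<close>, and take two leaves \<open>a\<close>,
  \<open>b\<close> of what remains. Putting \<open>i\<close> back can add only the point
  \<open>x\<close> to their shared parts. If both contain \<open>x\<close>, it was shared already;
  otherwise the one without \<open>x\<close> stays a leaf.\<close>

lemma two_leaves:
  assumes "sparse g I e" "finite J" "J \<subseteq> I" "card J < g" "2 \<le> card J"
  shows "\<exists>i\<in>J. \<exists>j\<in>J. i \<noteq> j \<and> (\<exists>x. shared e J i \<subseteq> {x}) \<and> (\<exists>y. shared e J j \<subseteq> {y})"
  using assms(2-)
proof (induction "card J" arbitrary: J rule: less_induct)
  case less
  obtain i x where i: "i \<in> J" "shared e J i \<subseteq> {x}"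
    using sparseD[OF assms(1), of J] less.prems by (metis card.empty not_numeral_le_zero)
  let ?J = "J - {i}"
  have cJ: "card ?J = card J - 1" using i less.prems by simp
  have other: "\<exists>j\<in>?J. \<exists>y. shared e J j \<subseteq> {y}"
  proof (cases "2 \<le> card ?J")
    case True
    have "\<exists>a\<in>?J. \<exists>b\<in>?J. a \<noteq> b \<and> (\<exists>x. shared e ?J a \<subseteq> {x}) \<and> (\<exists>y. shared e ?J b \<subseteq> {y})"
    proof (rule less.hyps)
      show "card ?J < card J" "card ?J < g" using cJ less.prems by linarith+
    qed (use less.prems True in auto)
    then obtain a b xa xb where ab: "a \<in> ?J" "b \<in> ?J" "a \<noteq> b"
      "shared e ?J a \<subseteq> {xa}" "shared e ?J b \<subseteq> {xb}" by blast
    have split: "shared e J c = shared e ?J c \<union> (e c \<inter> e i)" if "c \<in> ?J" for c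
      using that i(1) by (auto simp: shared_def)
    have meet: "e c \<inter> e i \<subseteq> {x}" if "c \<in> ?J" for c
      using that i(2) by (auto simp: shared_def)
    show ?thesis
    proof (cases "x \<in> e a \<and> x \<in> e b")
      case True
      then have "x \<in> shared e ?J a" using ab by (auto simp: shared_def)
      then have "shared e J a \<subseteq> {xa}" using split[OF ab(1)] meet[OF ab(1)] ab(4) by auto
      then show ?thesis using ab(1) by blast
    next
      case False
      then have "shared e J a \<subseteq> {xa} \<or> shared e J b \<subseteq> {xb}"
        using split[OF ab(1)] meet[OF ab(1)] split[OF ab(2)] meet[OF ab(2)] ab(4,5) by blast
      then show ?thesis using ab(1,2) by blast
    qed
  next
    case False
    then have "card ?J = 1" using cJ less.prems by linarith
    then obtain j where j: "?J = {j}" by (auto simp: card_1_singleton_iff)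
    then have "J = {i, j}" "i \<noteq> j" using i(1) by auto
    then have "shared e J j \<subseteq> {x}" using i(2) by (auto simp: shared_def)
    then show ?thesis using j by blast
  qed
  then show ?case using i by blast
qed

section \<open>Transport and amalgamation of sparse systems\<close>

lemma sparse_reindex:
  assumes "sparse g I (\<lambda>i. e (h i))" "inj_on h I"
  shows "sparse g (h ` I) e"
  unfolding sparse_def
proof (intro allI impI)
  fix J assume J: "J \<subseteq> h ` I" "finite J" "J \<noteq> {}" "card J < g"
  then obtain K where K: "K \<subseteq> I" "J = h ` K" by (meson subset_imageE)
  have inj: "inj_on h K" using K assms(2) inj_on_subset by blast
  have "finite K" "K \<noteq> {}" "card K < g"
    using J K inj by (auto simp: finite_image_iff card_image)
  then obtain i x where i: "i \<in> K" "shared (\<lambda>i. e (h i)) K i \<subseteq> {x}"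
    using sparseD[OF assms(1) K(1)] by metis
  have "shared e J (h i) \<subseteq> {x}"
    using i unfolding shared_def K(2) by blast
  then show "\<exists>i\<in>J. \<exists>x. shared e J i \<subseteq> {x}" using K i by blast
qed

lemma sparse_image:
  assumes "sparse g I e" "inj f"
  shows "sparse g I (\<lambda>i. f ` e i)"
  unfolding sparse_def
proof (intro allI impI)
  fix J assume J: "J \<subseteq> I" "finite J" "J \<noteq> {}" "card J < g"
  then obtain i x where i: "i \<in> J" "shared e J i \<subseteq> {x}"
    using sparseD[OF assms(1)] by metis
  have "shared (\<lambda>i. f ` e i) J i = f ` shared e J i"
    using assms(2) by (auto simp: shared_def inj_def)
  then show "\<exists>i\<in>J. \<exists>x. shared (\<lambda>i. f ` e i) J i \<subseteq> {x}" using i by blast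
qed

text \<open>Copies of \<open>e\<close>, one for each \<open>m\<close>, meet only in images of
  \<open>S\<close>, and there in the way the sets \<open>f m\<close> do. In a leafless subfamily
  \<open>F\<close>, every copy that occurs has two leaves of its own, each of which must meet
  another copy in a further point of \<open>S\<close>. So every occurring \<open>f m\<close> has two
  shared points. Since each such copy contributes at least two members, there are fewer copies than
  members: this is why sparsity \<open>g\<close> of \<open>f\<close> suffices for
  \<open>Suc g\<close>.\<close>

lemma sparse_amalgam:
  fixes \<phi> :: "'m \<Rightarrow> 'v \<Rightarrow> 'w" and V :: "'v set"
  assumes e: "sparse (Suc g) I e" and V: "V = (\<Union>j\<in>I. e j)"
    and f: "sparse g A f"
    and inj: "\<And>m. m \<in> A \<Longrightarrow> inj_on (\<phi> m) V"
    and once: "\<And>j x y. \<lbrakk>j \<in> I; x \<in> e j \<inter> S; y \<in> e j \<inter> S\<rbrakk> \<Longrightarrow> x = y"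
    and cross: "\<And>m m' x y. \<lbrakk>m \<in> A; m' \<in> A; m \<noteq> m'; x \<in> V; y \<in> V; \<phi> m x = \<phi> m' y\<rbrakk>
                  \<Longrightarrow> x \<in> S \<and> \<phi> m x \<in> f m \<inter> f m'"
  shows "sparse (Suc g) (A \<times> I) (\<lambda>(m, j). \<phi> m ` e j)"
  unfolding sparse_def
proof (intro allI impI, rule ccontr)
  fix F assume F: "F \<subseteq> A \<times> I" "finite F" "F \<noteq> {}" "card F < Suc g"
  let ?E = "\<lambda>(m, j). \<phi> m ` e j"
  assume "\<not> (\<exists>p\<in>F. \<exists>x. shared ?E F p \<subseteq> {x})"
  then have noleaf: "\<not> shared ?E F p \<subseteq> {x}" if "p \<in> F" for p x using that by blast
  have claim: "\<exists>j1 j2 z1 z2. (m, j1) \<in> F \<and> (m, j2) \<in> F \<and> j1 \<noteq> j2 \<and> z1 \<noteq> z2 \<and>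
      z1 \<in> shared f (fst ` F) m \<and> z2 \<in> shared f (fst ` F) m" if m: "m \<in> fst ` F" for m
  proof -
    define J where "J = {j. (m, j) \<in> F}"
    have mA: "m \<in> A" using m F(1) by auto
    have JI: "J \<subseteq> I" using F(1) by (auto simp: J_def)
    have sub: "Pair m ` J \<subseteq> F" by (auto simp: J_def)
    have finJ: "finite J" using sub F(2) by (metis finite_imageD finite_subset inj_on_def prod.inject)
    have cJ: "card J < Suc g"
      using card_mono[OF F(2) sub] F(4) card_image[of "Pair m" J] by (simp add: inj_on_def)
    have J0: "J \<noteq> {}" using m by (auto simp: J_def)
    \<comment> \<open>A leaf of its own copy is no leaf of \<open>F\<close>, so it has a shared
      point other than the image of \<open>x\<close>; that point can only be shared with a different
      copy.\<close>
    have outside: "\<exists>s\<in>e j \<inter> S. s \<noteq> x \<and> \<phi> m s \<in> shared f (fst ` F) m"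
      if j: "j \<in> J" and x: "shared e J j \<subseteq> {x}" for j x
    proof -
      have "(m, j) \<in> F" using j by (simp add: J_def)
      then obtain z where z: "z \<in> shared ?E F (m, j)" "z \<noteq> \<phi> m x"
        using noleaf[of "(m, j)" "\<phi> m x"] by blast
      from z(1) obtain m' j' where mj: "(m', j') \<in> F" "(m', j') \<noteq> (m, j)"
        "z \<in> \<phi> m ` e j" "z \<in> \<phi> m' ` e j'"
        unfolding shared_def by auto
      then obtain s t where st: "s \<in> e j" "t \<in> e j'" "z = \<phi> m s" "z = \<phi> m' t" by blast
      have sV: "s \<in> V" using st j JI V by blast
      have tV: "t \<in> V" using st mj F(1) V by blast
      have "m' \<noteq> m"
      proof
        assume eq: "m' = m"
        then have "s = t" using inj[OF mA] st sV tV by (auto simp: inj_on_def)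
        then have "s \<in> shared e J j"
          using st mj eq by (auto simp: shared_def J_def)
        then show False using x st z by auto
      qed
      moreover have "m' \<in> A" using mj F(1) by auto
      ultimately have "s \<in> S \<and> \<phi> m s \<in> f m \<inter> f m'"
        using cross[of m m' s t] mA sV tV st by auto
      moreover have "m' \<in> fst ` F - {m}" using mj \<open>m' \<noteq> m\<close> by force
      ultimately have "\<phi> m s \<in> shared f (fst ` F) m" "s \<in> S" by (auto simp: shared_def)
      moreover have "s \<noteq> x" using st z by blast
      ultimately show ?thesis using st(1) by blast
    qed
    have "\<exists>j1\<in>J. \<exists>j2\<in>J. j1 \<noteq> j2 \<and> (\<exists>x. shared e J j1 \<subseteq> {x}) \<and> (\<exists>y. shared e J j2 \<subseteq> {y})"
    proof (cases "2 \<le> card J")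
      case True
      then show ?thesis using two_leaves[OF e finJ JI cJ] by blast
    next
      case False
      then have "card J = 1" using J0 finJ by (metis One_nat_def Suc_1 card_gt_0_iff le_antisym not_less_eq_eq Suc_leI)
      then obtain j where j: "J = {j}" by (auto simp: card_1_singleton_iff)
      then have "shared e J j \<subseteq> {x}" for x by (auto simp: shared_def)
      \<comment> \<open>A lone member shares nothing inside its copy, so \<open>outside\<close>
        applies with every \<open>x\<close> and yields two points of \<open>S\<close> in one member,
        against \<open>once\<close>.\<close>
      then obtain s where s: "s \<in> e j \<inter> S" using outside[of j] j by blast
      then obtain s' where "s' \<in> e j \<inter> S" "s' \<noteq> s"
        using outside[of j s] j \<open>\<And>x. shared e J j \<subseteq> {x}\<close> by blast
      then show ?thesis using once[of j s s'] s j JI by auto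
    qed
    then obtain j1 j2 x1 x2 where j: "j1 \<in> J" "j2 \<in> J" "j1 \<noteq> j2"
      "shared e J j1 \<subseteq> {x1}" "shared e J j2 \<subseteq> {x2}" by blast
    obtain s1 where s1: "s1 \<in> e j1 \<inter> S" "s1 \<noteq> x1" "\<phi> m s1 \<in> shared f (fst ` F) m"
      using outside[OF j(1,4)] by blast
    obtain s2 where s2: "s2 \<in> e j2 \<inter> S" "s2 \<noteq> x2" "\<phi> m s2 \<in> shared f (fst ` F) m"
      using outside[OF j(2,5)] by blast
    have "s1 \<noteq> s2"
    proof
      assume "s1 = s2"
      then have "s1 \<in> shared e J j1" using s1 s2 j by (auto simp: shared_def)
      then show False using s1 j by auto
    qed
    moreover have "s1 \<in> V" "s2 \<in> V" using s1 s2 j JI V by blast+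
    ultimately have "\<phi> m s1 \<noteq> \<phi> m s2" using inj[OF mA] by (auto simp: inj_on_def)
    then show ?thesis using s1 s2 j by (auto simp: J_def)
  qed
  have MA: "fst ` F \<subseteq> A" using F(1) by auto
  obtain m where "m \<in> fst ` F" using F(3) by auto
  then obtain j1 j2 where "(m, j1) \<in> F" "(m, j2) \<in> F" "j1 \<noteq> j2" using claim by blast
  then have "\<not> inj_on fst F" using inj_onD[of fst F "(m, j1)" "(m, j2)"] by auto
  then have "card (fst ` F) < card F"
    using F(2) card_image_le[of F fst] eq_card_imp_inj_on[of F fst] by fastforce
  then have "card (fst ` F) < g" using F(4) by linarith
  then obtain m x where "m \<in> fst ` F" "shared f (fst ` F) m \<subseteq> {x}"
    using sparseD[OF f MA] F(2,3) by (metis finite_imageI image_is_empty)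
  then show False using claim[of m] by blast
qed

section \<open>Sparse Ramsey hypergraphs\<close>

text \<open>The hypergraph form of chromatic number above \<open>k\<close>. Colourings are total and
  bounded everywhere, so they can be composed with any map of vertices without attention to
  domains.\<close>

definition ramsey :: "nat \<Rightarrow> 'i set \<Rightarrow> ('i \<Rightarrow> 'v set) \<Rightarrow> bool" where
  "ramsey k I e \<longleftrightarrow>
     (\<forall>c :: 'v \<Rightarrow> nat. (\<forall>x. c x < k) \<longrightarrow> (\<exists>i\<in>I. \<exists>q. \<forall>x\<in>e i. c x = q))"

lemma pigeonhole_subset:
  fixes d :: "nat \<Rightarrow> nat"
  assumes "\<And>x. d x < k"
  obtains T q where "T \<subseteq> {..<k * r + 1}" "card T = r" "\<And>t. t \<in> T \<Longrightarrow> d t = q"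
proof -
  have "\<exists>q<k. r \<le> card {t \<in> {..<k * r + 1}. d t = q}"
  proof (rule ccontr)
    assume "\<not> ?thesis"
    then have le: "card {t \<in> {..<k * r + 1}. d t = q} \<le> r" if "q < k" for q
      using that by (metis linear)
    have "{..<k * r + 1} = (\<Union>q\<in>{..<k}. {t \<in> {..<k * r + 1}. d t = q})"
      using assms by auto
    then have "k * r + 1 = card (\<Union>q\<in>{..<k}. {t \<in> {..<k * r + 1}. d t = q})"
      by (metis card_lessThan)
    also have "\<dots> \<le> (\<Sum>q\<in>{..<k}. card {t \<in> {..<k * r + 1}. d t = q})"
      by (rule card_UN_le) simp
    also have "\<dots> \<le> (\<Sum>q\<in>{..<k}. r)" by (rule sum_mono) (use le in auto)
    finally show False by simp
  qed
  then obtain q where "r \<le> card {t \<in> {..<k * r + 1}. d t = q}" by blast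
  then obtain T where "T \<subseteq> {t \<in> {..<k * r + 1}. d t = q}" "card T = r"
    by (meson obtain_subset_with_card_n)
  then show ?thesis using that[of T q] by blast
qed

lemma subsets_enumeration:
  "\<exists>n (s :: nat \<Rightarrow> nat set). s ` {..<n} = {T. T \<subseteq> {..<a} \<and> card T = r}"
proof -
  have "finite {T. T \<subseteq> {..<a} \<and> card T = r}"
    by (rule finite_subset[of _ "Pow {..<a}"]) auto
  from ex_bij_betw_nat_finite[OF this] obtain s
    where "bij_betw s {0..<card {T. T \<subseteq> {..<a} \<and> card T = r}} {T. T \<subseteq> {..<a} \<and> card T = r}" ..
  then show ?thesis
    unfolding bij_betw_def atLeast0LessThan by (intro exI) (erule conjunct2)
qed

section \<open>Partite systems and amalgamation along one part\<close>

text \<open>A vertex of the partite system is a pair of its part and a label.  Only colourings that are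
  already constant on the parts from \<open>i\<close> onwards are considered; the amalgamation along part \<open>i\<close>
  removes the requirement for that part.\<close>

definition partite_ramsey ::
    "nat \<Rightarrow> nat \<Rightarrow> nat \<Rightarrow> nat set \<Rightarrow> (nat \<Rightarrow> (nat \<times> nat) set) \<Rightarrow> bool" where
  "partite_ramsey k a i I e \<longleftrightarrow>
     (\<forall>j\<in>I. inj_on fst (e j) \<and> fst ` e j \<subseteq> {..<a}) \<and>
     (\<forall>c :: nat \<times> nat \<Rightarrow> nat. (\<forall>v. c v < k) \<longrightarrow>
        (\<forall>v\<in>(\<Union>j\<in>I. e j). \<forall>w\<in>(\<Union>j\<in>I. e j). fst v = fst w \<longrightarrow> i \<le> fst v \<longrightarrow> c v = c w) \<longrightarrow>
        (\<exists>j\<in>I. \<exists>q. \<forall>v\<in>e j. c v = q))"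

lemma partite_ramseyI:
  assumes "\<And>j. j \<in> I \<Longrightarrow> inj_on fst (e j) \<and> fst ` e j \<subseteq> {..<a}"
    and "\<And>c. \<lbrakk>\<And>v. c v < k;
            \<And>v w. \<lbrakk>v \<in> (\<Union>j\<in>I. e j); w \<in> (\<Union>j\<in>I. e j); fst v = fst w; i \<le> fst v\<rbrakk> \<Longrightarrow> c v = c w\<rbrakk>
          \<Longrightarrow> \<exists>j\<in>I. \<exists>q. \<forall>v\<in>e j. c v = q"
  shows "partite_ramsey k a i I e"
  unfolding partite_ramsey_def
proof (intro conjI allI impI ballI)
  show "inj_on fst (e j)" "fst ` e j \<subseteq> {..<a}" if "j \<in> I" for j using assms(1)[OF that] by auto
  show "\<exists>j\<in>I. \<exists>q. \<forall>v\<in>e j. c v = q"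
    if "\<forall>v. c v < k"
      "\<forall>v\<in>(\<Union>j\<in>I. e j). \<forall>w\<in>(\<Union>j\<in>I. e j). fst v = fst w \<longrightarrow> i \<le> fst v \<longrightarrow> c v = c w" for c
  proof (rule assms(2))
    show "c v < k" for v using that(1) by blast
    show "c v = c w"
      if "v \<in> (\<Union>j\<in>I. e j)" "w \<in> (\<Union>j\<in>I. e j)" "fst v = fst w" "i \<le> fst v" for v w
      using \<open>\<forall>v\<in>_. _\<close>[rule_format, OF that] .
  qed
qed

lemma partite_ramseyD:
  assumes "partite_ramsey k a i I e" "\<And>v. c v < k"
    and "\<And>v w. \<lbrakk>v \<in> (\<Union>j\<in>I. e j); w \<in> (\<Union>j\<in>I. e j); fst v = fst w; i \<le> fst v\<rbrakk> \<Longrightarrow> c v = c w"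
  shows "\<exists>j\<in>I. \<exists>q. \<forall>v\<in>e j. c v = q"
  by (rule assms(1)[unfolded partite_ramsey_def, THEN conjunct2, rule_format])
    (rule assms(2,3); assumption)+

text \<open>Over each \<open>r\<close>-subset of the \<open>k * r + 1\<close> parts lies one edge,
  and its index serves as the label, so the edges are pairwise disjoint and sparse for every
  \<open>g\<close>. A colouring constant on all parts is a colouring of the parts, and the
  pigeonhole principle finds \<open>r\<close> of them with one colour.\<close>

lemma partite_ramsey_base:
  "\<exists>I e. finite I \<and> (\<forall>j\<in>I. finite (e j) \<and> card (e j) = r) \<and> sparse g I e \<and>
         partite_ramsey k (k * r + 1) 0 I e"
proof -
  obtain n and s :: "nat \<Rightarrow> nat set"
    where enum: "s ` {..<n} = {T. T \<subseteq> {..<k * r + 1} \<and> card T = r}"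
    using subsets_enumeration[of "k * r + 1" r] by (elim exE) (rule that)
  have s1: "\<exists>j<n. s j = T" if "T \<subseteq> {..<k * r + 1}" "card T = r" for T
  proof -
    have "T \<in> s ` {..<n}" unfolding enum using that by simp
    then show ?thesis by auto
  qed
  have s2: "s j \<subseteq> {..<k * r + 1}" "card (s j) = r" if "j < n" for j
  proof -
    have "s j \<in> s ` {..<n}" using that by simp
    then show "s j \<subseteq> {..<k * r + 1}" "card (s j) = r" unfolding enum by simp_all
  qed
  define e where "e j = (\<lambda>t. (t, j)) ` s j" for j :: nat
  have fin: "finite (s j)" if "j < n" for j using s2(1)[OF that] finite_subset by blast
  have mono_edge: "\<exists>j\<in>{..<n}. \<exists>q. \<forall>v\<in>e j. c v = q"
    if c: "\<And>v. c v < k" and const: "\<And>v w. \<lbrakk>v \<in> (\<Union>j<n. e j); w \<in> (\<Union>j<n. e j); fst v = fst w; 0 \<le> fst v\<rbrakk> \<Longrightarrow> c v = c w"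
    for c :: "nat \<times> nat \<Rightarrow> nat"
  proof -
    \<comment> \<open>The common colour of part \<open>t\<close>. For an empty part the choice is
      arbitrary, but the value is still below \<open>k\<close> because \<open>c\<close> is bounded
      everywhere.\<close>
    define d where "d t = c (SOME v. v \<in> (\<Union>j<n. e j) \<and> fst v = t)" for t
    obtain T q where T: "T \<subseteq> {..<k * r + 1}" "card T = r" "\<And>t. t \<in> T \<Longrightarrow> d t = q"
      by (rule pigeonhole_subset[of d k r]) (auto simp: d_def c)
    obtain j where j: "j < n" "s j = T" using s1 T by blast
    have "c v = q" if v: "v \<in> e j" for v
    proof -
      have vV: "v \<in> (\<Union>j<n. e j)" using v j by blast
      then have "(SOME w. w \<in> (\<Union>j<n. e j) \<and> fst w = fst v) \<in> (\<Union>j<n. e j) \<and>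
          fst (SOME w. w \<in> (\<Union>j<n. e j) \<and> fst w = fst v) = fst v"
        by - (rule someI[where P = "\<lambda>w. w \<in> (\<Union>j<n. e j) \<and> fst w = fst v" and x = v], simp)
      then have "c v = d (fst v)" unfolding d_def using const[OF vV] by (metis le0)
      also have "\<dots> = q" using T(3) v j by (auto simp: e_def)
      finally show ?thesis .
    qed
    then show ?thesis using j by blast
  qed
  have "partite_ramsey k (k * r + 1) 0 {..<n} e"
  proof (rule partite_ramseyI)
    show "inj_on fst (e j) \<and> fst ` e j \<subseteq> {..<k * r + 1}" if "j \<in> {..<n}" for j
      using s2(1)[of j] that by (auto simp: e_def inj_on_def)
  qed (rule mono_edge)
  moreover have "sparse g {..<n} e"
    unfolding sparse_def
  proof (intro allI impI)
    fix J :: "nat set" assume "J \<noteq> {}"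
    moreover have "shared e J i = {}" for i by (auto simp: shared_def e_def)
    ultimately show "\<exists>i\<in>J. \<exists>x. shared e J i \<subseteq> {x}" by blast
  qed
  moreover have "finite (e j) \<and> card (e j) = r" if "j < n" for j
    using s2[OF that] fin[OF that] by (simp add: e_def card_image inj_on_def)
  ultimately show ?thesis by blast
qed

text \<open>Take a Ramsey hypergraph whose edges have as many points as part \<open>i\<close>, and
  place one copy of the system on each edge \<open>f m\<close>: part \<open>i\<close> goes
  bijectively onto \<open>f m\<close>, all else stays disjoint. If \<open>f m\<close> is
  monochromatic, the colouring of copy \<open>m\<close> is constant on part \<open>i\<close> too, so
  the hypothesis on the old system applies to it. The auxiliary hypergraph needs only sparsity
  \<open>g\<close>, but an edge size that is not known in advance.\<close>

lemma partite_ramsey_step: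
  fixes e :: "nat \<Rightarrow> (nat \<times> nat) set"
  assumes fin: "finite I" and unif: "\<forall>j\<in>I. finite (e j) \<and> card (e j) = r"
    and sp: "sparse (Suc g) I e" and pr: "partite_ramsey k a i I e"
    and aux: "\<And>n. \<exists>(A :: nat set) (f :: nat \<Rightarrow> nat set).
        finite A \<and> (\<forall>m\<in>A. finite (f m) \<and> card (f m) = n) \<and> sparse g A f \<and> ramsey k A f"
  shows "\<exists>I e. finite I \<and> (\<forall>j\<in>I. finite (e j) \<and> card (e j) = r) \<and> sparse (Suc g) I e \<and>
         partite_ramsey k a (Suc i) I e"
proof -
  define V where "V = (\<Union>j\<in>I. e j)"
  define X where "X = {x. (i, x) \<in> V}"
  have finV: "finite V" using fin unif by (auto simp: V_def)
  have finX: "finite X"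
    by (rule finite_subset[of _ "snd ` V"]) (use finV in \<open>force simp: X_def\<close>)+
  obtain A :: "nat set" and f :: "nat \<Rightarrow> nat set" where A: "finite A" "\<And>m. m \<in> A \<Longrightarrow> finite (f m) \<and> card (f m) = card X"
      "sparse g A f" "ramsey k A f"
    using aux[of "card X"] by blast
  have "\<exists>h. bij_betw h X (f m)" if "m \<in> A" for m
    using finite_same_card_bij[OF finX] A(2)[OF that] by metis
  then obtain h where h: "\<And>m. m \<in> A \<Longrightarrow> bij_betw (h m) X (f m)" by metis
  \<comment> \<open>Labels in part \<open>i\<close> are glued into \<open>f m\<close>; all others
    are tagged with \<open>m\<close>, so different copies meet in part \<open>i\<close> alone. The
    part of a vertex never changes.\<close>
  define \<phi> where "\<phi> m v = (if fst v = i then (i, h m (snd v)) else (fst v, prod_encode (m, snd v)))"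
    for m v
  have fst_\<phi> [simp]: "fst (\<phi> m v) = fst v" for m v by (simp add: \<phi>_def)
  have inj\<phi>: "inj_on (\<phi> m) V" if m: "m \<in> A" for m
  proof (rule inj_onI)
    fix v w assume vw: "v \<in> V" "w \<in> V" "\<phi> m v = \<phi> m w"
    then have eq: "fst v = fst w" by (metis fst_\<phi>)
    show "v = w"
    proof (cases "fst v = i")
      case True
      then have "snd v \<in> X" "snd w \<in> X" "h m (snd v) = h m (snd w)"
        using vw eq by (auto simp: X_def \<phi>_def) (metis prod.collapse)+
      then show ?thesis using h[OF m] eq by (auto simp: bij_betw_def inj_on_def prod_eq_iff)
    next
      case False
      then show ?thesis using vw eq by (auto simp: \<phi>_def prod_eq_iff)
    qed
  qed
  define e' where "e' p = (case prod_decode p of (m, j) \<Rightarrow> \<phi> m ` e j)" for p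
  define I' where "I' = prod_encode ` (A \<times> I)"
  have e'_enc [simp]: "e' (prod_encode (m, j)) = \<phi> m ` e j" for m j by (simp add: e'_def)
  have eV: "e j \<subseteq> V" if "j \<in> I" for j using that by (auto simp: V_def)
  have "sparse (Suc g) (A \<times> I) (\<lambda>(m, j). \<phi> m ` e j)"
  proof (rule sparse_amalgam[where S = "{v. fst v = i}" and V = V and f = "\<lambda>m. Pair i ` f m"])
    show "sparse g A (\<lambda>m. Pair i ` f m)" by (rule sparse_image[OF A(3)]) (simp add: inj_def)
    show "x = y" if "j \<in> I" "x \<in> e j \<inter> {v. fst v = i}" "y \<in> e j \<inter> {v. fst v = i}" for j x y
      using pr that unfolding partite_ramsey_def inj_on_def by auto
    show "x \<in> {v. fst v = i} \<and> \<phi> m x \<in> Pair i ` f m \<inter> Pair i ` f m'"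
      if "m \<in> A" "m' \<in> A" "m \<noteq> m'" "x \<in> V" "y \<in> V" "\<phi> m x = \<phi> m' y" for m m' x y
    proof -
      have eq: "fst x = fst y" using that by (metis fst_\<phi>)
      have xi: "fst x = i"
      proof (rule ccontr)
        assume "fst x \<noteq> i"
        then show False using that eq by (simp add: \<phi>_def)
      qed
      have "snd x \<in> X" "snd y \<in> X"
        using that xi eq by (auto simp: X_def) (metis prod.collapse)+
      then have "h m (snd x) \<in> f m" "h m' (snd y) \<in> f m'"
        using h that by (meson bij_betwE)+
      then show ?thesis using xi eq that by (auto simp: \<phi>_def)
    qed
  qed (use sp inj\<phi> in \<open>auto simp: V_def\<close>)
  then have "sparse (Suc g) (A \<times> I) (\<lambda>p. e' (prod_encode p))"
    by (simp add: case_prod_unfold e'_def)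
  then have sp': "sparse (Suc g) I' e'"
    unfolding I'_def by (rule sparse_reindex) (simp add: inj_prod_encode)
  have unif': "finite (e' p) \<and> card (e' p) = r" if "p \<in> I'" for p
    using that unif inj_on_subset[OF inj\<phi> eV] by (auto simp: I'_def card_image)
  have mono_edge: "\<exists>p\<in>I'. \<exists>q. \<forall>v\<in>e' p. c v = q"
    if c: "\<And>v. c v < k"
      and const: "\<And>v w. \<lbrakk>v \<in> (\<Union>j\<in>I'. e' j); w \<in> (\<Union>j\<in>I'. e' j); fst v = fst w; Suc i \<le> fst v\<rbrakk> \<Longrightarrow> c v = c w"
    for c :: "nat \<times> nat \<Rightarrow> nat"
  proof -
    obtain m q where m: "m \<in> A" "\<And>y. y \<in> f m \<Longrightarrow> c (i, y) = q"
      using A(4)[unfolded ramsey_def, rule_format, of "\<lambda>y. c (i, y)"] c by blast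
    have V': "\<phi> m v \<in> (\<Union>j\<in>I'. e' j)" if v: "v \<in> V" for v
    proof -
      from v obtain j where j: "j \<in> I" "v \<in> e j" by (auto simp: V_def)
      then have "prod_encode (m, j) \<in> I'" "\<phi> m v \<in> e' (prod_encode (m, j))"
        using m(1) by (auto simp: I'_def)
      then show ?thesis by blast
    qed
    have same: "c (\<phi> m v) = c (\<phi> m w)" if vw: "v \<in> V" "w \<in> V" "fst v = fst w" "i \<le> fst v" for v w
    proof (cases "fst v = i")
      case True
      then have "snd v \<in> X" "snd w \<in> X"
        using vw by (auto simp: X_def) (metis prod.collapse)+
      then have "h m (snd v) \<in> f m" "h m (snd w) \<in> f m"
        using h[OF m(1)] by (meson bij_betwE)+
      then show ?thesis using m(2) True vw by (simp add: \<phi>_def)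
    next
      case False
      show ?thesis
        by (rule const[OF V'[OF vw(1)] V'[OF vw(2)]]) (use vw False in simp_all)
    qed
    obtain j q where "j \<in> I" "\<forall>v\<in>e j. c (\<phi> m v) = q"
      using partite_ramseyD[OF pr, of "\<lambda>v. c (\<phi> m v)", OF c same[unfolded V_def]] by blast
    then have "prod_encode (m, j) \<in> I'" "\<forall>v\<in>e' (prod_encode (m, j)). c v = q"
      using m(1) by (auto simp: I'_def)
    then show ?thesis by blast
  qed
  have parts: "inj_on fst (e' p) \<and> fst ` e' p \<subseteq> {..<a}" if "p \<in> I'" for p
  proof -
    from that obtain m j where mj: "p = prod_encode (m, j)" "m \<in> A" "j \<in> I"
      by (auto simp: I'_def)
    have "inj_on fst (e j)" "fst ` e j \<subseteq> {..<a}" using pr mj by (auto simp: partite_ramsey_def)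
    then show ?thesis unfolding mj e'_enc by (auto simp: inj_on_def)
  qed
  have "partite_ramsey k a (Suc i) I' e'"
    by (rule partite_ramseyI) (rule parts mono_edge; assumption)+
  moreover have "finite I'" using fin A(1) by (simp add: I'_def)
  ultimately show ?thesis using sp' unif' by blast
qed

text \<open>Induction on \<open>g\<close> for all edge sizes at once, since the amalgamation for
  \<open>Suc g\<close> uses hypergraphs of sparsity \<open>g\<close> with much larger edges. An
  inner induction processes the parts one after another.\<close>

theorem sparse_ramsey_hypergraph:
  "\<exists>(I :: nat set) (e :: nat \<Rightarrow> nat set).
     finite I \<and> (\<forall>j\<in>I. finite (e j) \<and> card (e j) = r) \<and> sparse g I e \<and> ramsey k I e"
proof (induction g arbitrary: r)
  case 0
  obtain n and s :: "nat \<Rightarrow> nat set"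
    where enum: "s ` {..<n} = {T. T \<subseteq> {..<k * r + 1} \<and> card T = r}"
    using subsets_enumeration[of "k * r + 1" r] by (elim exE) (rule that)
  have s1: "\<exists>j<n. s j = T" if "T \<subseteq> {..<k * r + 1}" "card T = r" for T
  proof -
    have "T \<in> s ` {..<n}" unfolding enum using that by simp
    then show ?thesis by auto
  qed
  have s2: "s j \<subseteq> {..<k * r + 1}" "card (s j) = r" if "j < n" for j
  proof -
    have "s j \<in> s ` {..<n}" using that by simp
    then show "s j \<subseteq> {..<k * r + 1}" "card (s j) = r" unfolding enum by simp_all
  qed
  \<comment> \<open>The complete \<open>r\<close>-uniform hypergraph on \<open>k * r + 1\<close>
    points serves here, since \<open>sparse 0\<close> is vacuous.\<close>
  have "ramsey k {..<n} s"
    unfolding ramsey_def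
  proof (intro allI impI)
    fix c :: "nat \<Rightarrow> nat" assume "\<forall>x. c x < k"
    then obtain T q where "T \<subseteq> {..<k * r + 1}" "card T = r" "\<And>t. t \<in> T \<Longrightarrow> c t = q"
      using pigeonhole_subset[of c k r] by blast
    then show "\<exists>i\<in>{..<n}. \<exists>q. \<forall>x\<in>s i. c x = q" using s1[of T] by blast
  qed
  moreover have "finite (s j) \<and> card (s j) = r" if "j < n" for j
    using s2[OF that] finite_subset by blast
  ultimately show ?case unfolding sparse_def by blast
next
  case (Suc g)
  note aux = Suc.IH
  let ?a = "k * r + 1"
  have "\<exists>I e. finite I \<and> (\<forall>j\<in>I. finite (e j) \<and> card (e j) = r) \<and> sparse (Suc g) I e \<and>
         partite_ramsey k ?a i I e" for i :: nat
  proof (induction i)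
    case 0
    show ?case by (rule partite_ramsey_base)
  next
    case (Suc i)
    then obtain I and e :: "nat \<Rightarrow> (nat \<times> nat) set" where *: "finite I" "\<forall>j\<in>I. finite (e j) \<and> card (e j) = r"
      "sparse (Suc g) I e" "partite_ramsey k ?a i I e" by blast
    show ?case by (rule partite_ramsey_step[OF * aux])
  qed
  from this[of ?a] obtain I and e :: "nat \<Rightarrow> (nat \<times> nat) set" where *: "finite I" "\<forall>j\<in>I. finite (e j) \<and> card (e j) = r"
      "sparse (Suc g) I e" "partite_ramsey k ?a ?a I e" by blast
  define e' where "e' j = prod_encode ` e j" for j :: nat
  have "ramsey k I e'"
    unfolding ramsey_def
  proof (intro allI impI)
    fix c :: "nat \<Rightarrow> nat" assume c: "\<forall>x. c x < k"
    \<comment> \<open>After \<open>?a\<close> amalgamations no part has an index of at least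
      \<open>?a\<close>, so the constancy requirement has become void and arbitrary colourings are
      covered.\<close>
    have low: "fst v < ?a" if "v \<in> (\<Union>j\<in>I. e j)" for v
      using *(4) that unfolding partite_ramsey_def by fastforce
    have "\<exists>j\<in>I. \<exists>q. \<forall>v\<in>e j. c (prod_encode v) = q"
    proof (rule partite_ramseyD[OF *(4)])
      show "c (prod_encode v) < k" for v using c by blast
      show "c (prod_encode v) = c (prod_encode w)"
        if "v \<in> (\<Union>j\<in>I. e j)" "w \<in> (\<Union>j\<in>I. e j)" "fst v = fst w" "?a \<le> fst v" for v w
        using low[OF that(1)] that(4) by linarith
    qed
    then obtain j q where "j \<in> I" "\<forall>v\<in>e j. c (prod_encode v) = q" by blast
    then have "j \<in> I" "\<forall>x\<in>e' j. c x = q" by (simp_all add: e'_def)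
    then show "\<exists>i\<in>I. \<exists>q. \<forall>x\<in>e' i. c x = q" by blast
  qed
  moreover have "sparse (Suc g) I e'"
    unfolding e'_def by (rule sparse_image[OF *(3)]) (simp add: inj_prod_encode)
  moreover have "finite (e' j) \<and> card (e' j) = r" if "j \<in> I" for j
    using *(2) that by (simp add: e'_def card_image inj_prod_encode)
  ultimately show ?case using *(1) by blast
qed

section \<open>Cells\<close>

text \<open>The box of a cell is \<open>[pos, right] \<times> [low, pos] \<times> [bot, top]\<close>.\<close>

datatype cell = Cell (pos: nat) (right: nat) (low: nat) (bot: nat) (top: nat)

definition valid :: "cell \<Rightarrow> bool" where
  "valid s \<longleftrightarrow> low s \<le> pos s \<and> pos s \<le> right s \<and> bot s \<le> top s"

definition touches :: "cell \<Rightarrow> cell \<Rightarrow> bool" where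
  "touches s t \<longleftrightarrow> pos s \<le> right t \<and> pos t \<le> right s \<and> low s \<le> pos t \<and> low t \<le> pos s \<and>
     bot s \<le> top t \<and> bot t \<le> top s"

text \<open>Applied to the stars (the incident edges) of the vertices, sparsity of a set system says that
  every small set of vertices induces a subgraph with a vertex of degree at most one.\<close>

definition star :: "cell \<Rightarrow> cell set set" where
  "star s = {{s, t} | t. t \<noteq> s \<and> touches s t}"

lemma touches_sym: "touches s t \<longleftrightarrow> touches t s"
  by (auto simp: touches_def)

text \<open>An edge at \<open>s\<close> lies in the star of another cell \<open>w\<close> only if it
  is the edge joining \<open>s\<close> to \<open>w\<close>. So the shared part of the star
  corresponds to the neighbours of \<open>s\<close> in \<open>W\<close>, and a leaf is a vertex of
  degree at most one.\<close>

lemma shared_star: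
  "(\<exists>x. shared star W s \<subseteq> {x}) \<longleftrightarrow>
     (\<forall>t\<in>W. \<forall>u\<in>W. t \<noteq> s \<and> touches s t \<longrightarrow> u \<noteq> s \<and> touches s u \<longrightarrow> t = u)"
proof -
  have eq: "shared star W s = (\<lambda>t. {s, t}) ` {t \<in> W. t \<noteq> s \<and> touches s t}"
  proof
    show "shared star W s \<subseteq> (\<lambda>t. {s, t}) ` {t \<in> W. t \<noteq> s \<and> touches s t}"
    proof
      fix x assume "x \<in> shared star W s"
      then obtain t w u where *: "x = {s, t}" "t \<noteq> s" "touches s t" "w \<in> W" "w \<noteq> s" "x = {w, u}"
        unfolding shared_def star_def by auto
      then have "w = t" by (auto simp: doubleton_eq_iff)
      then show "x \<in> (\<lambda>t. {s, t}) ` {t \<in> W. t \<noteq> s \<and> touches s t}" using * by blast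
    qed
    show "(\<lambda>t. {s, t}) ` {t \<in> W. t \<noteq> s \<and> touches s t} \<subseteq> shared star W s"
    proof clarify
      fix t assume t: "t \<in> W" "t \<noteq> s" "touches s t"
      then have "{s, t} \<in> star s" "{s, t} \<in> star t"
        using touches_sym[of s t] by (auto simp: star_def insert_commute)
      then show "{s, t} \<in> shared star W s" using t by (auto simp: shared_def)
    qed
  qed
  show ?thesis
  proof
    assume "\<exists>x. shared star W s \<subseteq> {x}"
    then obtain x where "(\<lambda>t. {s, t}) ` {t \<in> W. t \<noteq> s \<and> touches s t} \<subseteq> {x}" unfolding eq ..
    then have x: "{s, t} = x" if "t \<in> W" "t \<noteq> s \<and> touches s t" for t using that by blast
    show "\<forall>t\<in>W. \<forall>u\<in>W. t \<noteq> s \<and> touches s t \<longrightarrow> u \<noteq> s \<and> touches s u \<longrightarrow> t = u"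
    proof (intro ballI impI)
      fix t u assume "t \<in> W" "u \<in> W" "t \<noteq> s \<and> touches s t" "u \<noteq> s \<and> touches s u"
      then have "{s, t} = {s, u}" using x by metis
      then show "t = u" by (auto simp: doubleton_eq_iff)
    qed
  next
    assume *: "\<forall>t\<in>W. \<forall>u\<in>W. t \<noteq> s \<and> touches s t \<longrightarrow> u \<noteq> s \<and> touches s u \<longrightarrow> t = u"
    show "\<exists>x. shared star W s \<subseteq> {x}"
    proof (cases "\<exists>t\<in>W. t \<noteq> s \<and> touches s t")
      case True
      then obtain t where "t \<in> W" "t \<noteq> s \<and> touches s t" by blast
      then have "{t \<in> W. t \<noteq> s \<and> touches s t} \<subseteq> {t}" using * by blast
      then have "shared star W s \<subseteq> {{s, t}}" unfolding eq by blast
      then show ?thesis ..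
    next
      case False
      then have "shared star W s = {}" unfolding eq by blast
      then show ?thesis by simp
    qed
  qed
qed

text \<open>Chromatic number above \<open>k\<close> for the touching graph. For \<open>k = 0\<close>
  it only means that \<open>B\<close> is non-empty, so the recursion can start from a single
  cell.\<close>

definition chromatic_cells :: "nat \<Rightarrow> cell set \<Rightarrow> bool" where
  "chromatic_cells k B \<longleftrightarrow>
     (\<forall>c :: cell \<Rightarrow> nat. (\<forall>s\<in>B. c s < k) \<longrightarrow>
        (\<exists>s\<in>B. \<exists>t\<in>B. s \<noteq> t \<and> touches s t \<and> c s = c t))"

section \<open>One step of the Tutte construction\<close>

text \<open>\<open>B\<close> is the previous configuration and \<open>e m\<close> are the
  hyperedges, with \<open>f m\<close> the increasing enumeration of \<open>e m\<close>. Edges have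
  \<open>K\<close> points, not one for each cell, because \<open>f m\<close> relabels the ends
  \<open>low\<close> and \<open>right\<close> as well as \<open>pos\<close>. \<open>Z\<close> is the
  height of a layer.\<close>

locale descartes =
  fixes g k K M Z :: nat and B :: "cell set" and e :: "nat \<Rightarrow> nat set" and f :: "nat \<Rightarrow> nat \<Rightarrow> nat"
  assumes finB: "finite B" and posB: "inj_on pos B" and validB: "\<And>s. s \<in> B \<Longrightarrow> valid s"
    and sparseB: "sparse g B star"
    and rightB: "\<And>s. s \<in> B \<Longrightarrow> right s < K" and topB: "\<And>s. s \<in> B \<Longrightarrow> top s < Z"
    and f_edge: "\<And>m. m < M \<Longrightarrow> f m ` {..<K} = e m"
    and f_mono: "\<And>m. m < M \<Longrightarrow> strict_mono_on {..<K} (f m)"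
    and sparse_e: "sparse g {..<M} e"
begin

text \<open>Each hypergraph vertex \<open>x\<close> owns a block of positions: slot 0 is for its line, slot \<open>m + 1\<close> for
  the cell of the copy \<open>m\<close> matched with it.  The copy reaches down to slot 0 of its lowest block, so
  that a cell whose \<open>low\<close> equals its \<open>pos\<close> still meets its line.\<close>

definition slot :: "nat \<Rightarrow> nat \<Rightarrow> nat" where
  "slot x r = x * Suc M + r"

text \<open>Flat in the second coordinate, covering its whole block in the first, and tall enough to
  cross all \<open>M\<close> layers.\<close>

definition line :: "nat \<Rightarrow> cell" where
  "line x = Cell (slot x 0) (slot x M) (slot x 0) 0 (M * Z)"

definition copy :: "nat \<Rightarrow> cell \<Rightarrow> cell" where
  "copy m s = Cell (slot (f m (pos s)) (Suc m)) (slot (f m (right s)) (Suc m)) (slot (f m (low s)) 0)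
     (m * Z + bot s) (m * Z + top s)"

definition lines :: "cell set" where
  "lines = line ` (\<Union>m<M. f m ` pos ` B)"

definition copies :: "cell set" where
  "copies = (\<Union>m<M. copy m ` B)"

lemma line_simps [simp]:
  "pos (line x) = slot x 0" "right (line x) = slot x M" "low (line x) = slot x 0"
  "bot (line x) = 0" "top (line x) = M * Z"
  by (simp_all add: line_def)

lemma copy_simps [simp]:
  "pos (copy m s) = slot (f m (pos s)) (Suc m)"
  "right (copy m s) = slot (f m (right s)) (Suc m)"
  "low (copy m s) = slot (f m (low s)) 0"
  "bot (copy m s) = m * Z + bot s" "top (copy m s) = m * Z + top s"
  by (simp_all add: copy_def)

text \<open>Slots are at most \<open>M\<close>, less than the block length \<open>Suc M\<close>, so
  positions are ordered lexicographically by block and slot.\<close>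

lemma slot_le_iff:
  assumes "r \<le> M" "r' \<le> M"
  shows "slot x r \<le> slot y r' \<longleftrightarrow> x < y \<or> x = y \<and> r \<le> r'"
proof -
  have less: "slot x r < slot y r'" if "x < y" "r \<le> M" for x y r r'
  proof -
    have "slot x r < Suc x * Suc M" using that(2) by (simp add: slot_def)
    also have "\<dots> \<le> y * Suc M" using that(1) by (intro mult_le_mono1) simp
    also have "\<dots> \<le> slot y r'" by (simp add: slot_def)
    finally show ?thesis .
  qed
  consider "x < y" | "x = y" | "y < x" by linarith
  then show ?thesis
  proof cases
    case 1
    then show ?thesis using less[of x y r r'] assms by simp
  next
    case 2
    then show ?thesis by (simp add: slot_def)
  next
    case 3
    then show ?thesis using less[of y x r' r] assms by simp
  qed
qed

lemma slot_eq_iff: "r \<le> M \<Longrightarrow> r' \<le> M \<Longrightarrow> slot x r = slot y r' \<longleftrightarrow> x = y \<and> r = r'"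
  using slot_le_iff[of r r' x y] slot_le_iff[of r' r y x] by (auto simp: le_antisym)

lemma bounds:
  assumes "s \<in> B"
  shows "pos s < K" "right s < K" "low s < K" "low s \<le> pos s" "pos s \<le> right s" "bot s \<le> top s" "top s < Z"
  using validB[OF assms] rightB[OF assms] topB[OF assms] by (auto simp: valid_def)

lemma f_le_iff: "m < M \<Longrightarrow> x < K \<Longrightarrow> y < K \<Longrightarrow> f m x \<le> f m y \<longleftrightarrow> x \<le> y"
  using strict_mono_on_less_eq[OF f_mono] by simp

lemma f_eq_iff: "m < M \<Longrightarrow> x < K \<Longrightarrow> y < K \<Longrightarrow> f m x = f m y \<longleftrightarrow> x = y"
  using f_le_iff[of m x y] f_le_iff[of m y x] by force

lemma copy_eq_iff:
  assumes "m < M" "m' < M" "s \<in> B" "t \<in> B"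
  shows "copy m s = copy m' t \<longleftrightarrow> m = m' \<and> s = t"
proof
  assume "copy m s = copy m' t"
  then have "pos (copy m s) = pos (copy m' t)" by simp
  then have "m = m'" "f m (pos s) = f m' (pos t)" using assms by (auto simp: slot_eq_iff)
  then have "m = m'" "pos s = pos t" using f_eq_iff bounds(1) assms by auto
  then show "m = m' \<and> s = t" using posB assms by (auto simp: inj_on_def)
qed simp

lemma line_neq_copy: "m < M \<Longrightarrow> line x \<noteq> copy m s"
proof
  assume m: "m < M" and "line x = copy m s"
  then have "pos (line x) = pos (copy m s)" by simp
  then show False using m by (simp add: slot_eq_iff)
qed

lemma touches_lines: "touches (line x) (line y) \<Longrightarrow> x = y"
  by (auto simp: touches_def slot_le_iff)

text \<open>The line covers block \<open>x\<close> in the first coordinate and sits at its start in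
  the second; together these bounds force the corner of the copied cell into block \<open>x\<close>.
  Conversely, the copied cell reaches down to slot 0 of its block, and layer \<open>m\<close> lies
  below \<open>M * Z\<close>.\<close>

lemma touches_line_copy:
  assumes "m < M" "s \<in> B"
  shows "touches (line x) (copy m s) \<longleftrightarrow> x = f m (pos s)"
proof
  assume "touches (line x) (copy m s)"
  then show "x = f m (pos s)" using assms(1) by (auto simp: touches_def slot_le_iff)
next
  assume x: "x = f m (pos s)"
  have "f m (pos s) \<le> f m (right s)" "f m (low s) \<le> f m (pos s)"
    using f_le_iff[OF assms(1)] bounds[OF assms(2)] by simp_all
  moreover have "m * Z + bot s \<le> M * Z"
  proof -
    have "m * Z + bot s \<le> (m + 1) * Z" using bounds(6,7)[OF assms(2)] by simp
    also have "\<dots> \<le> M * Z" using assms(1) by (intro mult_le_mono1) simp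
    finally show ?thesis .
  qed
  ultimately show "touches (line x) (copy m s)"
    using assms(1) by (auto simp: touches_def slot_le_iff x)
qed

text \<open>Different layers are disjoint because heights in \<open>B\<close> stay below
  \<open>Z\<close>. Inside one layer every comparison is one between values of \<open>f m\<close>,
  which is strictly increasing.\<close>

lemma touches_copies:
  assumes "m < M" "m' < M" "s \<in> B" "t \<in> B"
  shows "touches (copy m s) (copy m' t) \<longleftrightarrow> m = m' \<and> touches s t"
proof -
  have level: "n = n'" if "n * Z + bot s \<le> n' * Z + top t" "n' * Z + bot t \<le> n * Z + top s" for n n'
  proof (rule ccontr)
    assume "n \<noteq> n'"
    then consider "n + 1 \<le> n'" | "n' + 1 \<le> n" by linarith
    then show False
    proof cases
      case 1
      then have "(n + 1) * Z \<le> n' * Z" by (rule mult_le_mono1)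
      then show False using that bounds(7)[OF assms(3)] by simp
    next
      case 2
      then have "(n' + 1) * Z \<le> n * Z" by (rule mult_le_mono1)
      then show False using that bounds(7)[OF assms(4)] by simp
    qed
  qed
  \<comment> \<open>Moving \<open>low\<close> to slot 0 changes no comparison with a corner:
    different blocks decide by themselves, and for equal blocks the inequality holds either
    way.\<close>
  have order: "slot (f m a) 0 \<le> slot (f m b) (Suc m) \<longleftrightarrow> a \<le> b"
    "slot (f m a) (Suc m) \<le> slot (f m b) (Suc m) \<longleftrightarrow> a \<le> b" if "a < K" "b < K" for a b
    using f_le_iff[OF assms(1) that] assms(1) by (auto simp: slot_le_iff)
  show ?thesis
  proof (cases "m = m'")
    case True
    then show ?thesis
      unfolding touches_def copy_simps using order bounds[OF assms(3)] bounds[OF assms(4)] by simp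
  next
    case False
    then show ?thesis using level[of m m'] by (auto simp: touches_def)
  qed
qed

lemma finite_cells: "finite (lines \<union> copies)"
  using finB by (simp add: lines_def copies_def)

lemma valid_cells: "s \<in> lines \<union> copies \<Longrightarrow> valid s"
proof -
  have "valid (copy m s)" if "m < M" "s \<in> B" for m s
  proof -
    \<comment> \<open>A cell is valid exactly if it touches itself.\<close>
    have "touches (copy m s) (copy m s)"
      using touches_copies[of m m s s] that bounds[OF that(2)] by (simp add: touches_def)
    then show ?thesis by (simp only: touches_def valid_def)
  qed
  moreover have "valid (line x)" for x by (simp add: valid_def slot_le_iff)
  ultimately show "s \<in> lines \<union> copies \<Longrightarrow> valid s" by (auto simp: lines_def copies_def)
qed

lemma inj_pos: "inj_on pos (lines \<union> copies)"
proof (rule inj_onI)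
  fix s t assume st: "s \<in> lines \<union> copies" "t \<in> lines \<union> copies" "pos s = pos t"
  have lc: "pos (line x) \<noteq> pos (copy m u)" if "m < M" for x m u
    using that by (simp add: slot_eq_iff)
  consider x y where "s = line x" "t = line y"
    | x m u where "s = line x" "t = copy m u" "m < M"
    | x m u where "t = line x" "s = copy m u" "m < M"
    | m u m' u' where "s = copy m u" "t = copy m' u'" "m < M" "m' < M" "u \<in> B" "u' \<in> B"
    using st(1,2) unfolding lines_def copies_def by blast
  then show "s = t"
  proof cases
    case 1
    then show ?thesis using st(3) by (simp add: slot_eq_iff)
  next
    case 2
    then show ?thesis using st(3) lc by metis
  next
    case 3
    then show ?thesis using st(3) lc by metis
  next
    case 4
    then have "m = m'" "f m (pos u) = f m' (pos u')" using st(3) by (auto simp: slot_eq_iff)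
    then have "m = m'" "pos u = pos u'" using f_eq_iff bounds(1) 4 by auto
    then show ?thesis using 4 posB by (auto simp: inj_on_def)
  qed
qed

text \<open>Suppose \<open>W\<close> is small and leafless. Each of its lines meets two different
  copies, so its vertex lies in two hyperedges whose copies occur in \<open>W\<close>. Among the
  occurring hyperedges some \<open>e m\<close> has at most one shared point. But the cells of
  \<open>W\<close> in copy \<open>m\<close> have two leaves, both need their lines in
  \<open>W\<close>, and the positions of these lines are two shared points of
  \<open>e m\<close>.\<close>

lemma sparse_cells: "sparse g (lines \<union> copies) star"
  unfolding sparse_def
proof (intro allI impI, rule ccontr)
  fix W assume W: "W \<subseteq> lines \<union> copies" "finite W" "W \<noteq> {}" "card W < g"
  assume noleaf: "\<not> (\<exists>s\<in>W. \<exists>x. shared star W s \<subseteq> {x})"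
  have two: "\<exists>t\<in>W. \<exists>u\<in>W. t \<noteq> s \<and> u \<noteq> s \<and> t \<noteq> u \<and> touches s t \<and> touches s u" if "s \<in> W" for s
  proof -
    have "\<not> (\<exists>x. shared star W s \<subseteq> {x})" using noleaf that by blast
    then show ?thesis unfolding shared_star by blast
  qed
  define J where "J = {m. m < M \<and> copy m ` B \<inter> W \<noteq> {}}"
  have nbr_line: "\<exists>m s. m \<in> J \<and> s \<in> B \<and> t = copy m s \<and> x = f m (pos s)"
    if t: "t \<in> W" "t \<noteq> line x" "touches (line x) t" for t x
  proof -
    have "t \<notin> lines" using t touches_lines unfolding lines_def by blast
    then obtain m s where ms: "m < M" "s \<in> B" "t = copy m s" using t W(1) unfolding copies_def by blast
    then have "m \<in> J" using t by (auto simp: J_def)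
    then show ?thesis using ms t touches_line_copy by blast
  qed
  \<comment> \<open>One copy supplies at most one neighbour of a line, so two neighbours mean two
    copies, and one of these differs from any given \<open>m\<close>.\<close>
  have line_two: "\<exists>m'\<in>J. m' \<noteq> m \<and> x \<in> e m'" if x: "line x \<in> W" for x m
  proof -
    obtain t u where tu: "t \<in> W" "u \<in> W" "t \<noteq> line x" "u \<noteq> line x" "t \<noteq> u"
      "touches (line x) t" "touches (line x) u" using two[OF x] by blast
    obtain m1 s1 where 1: "m1 \<in> J" "s1 \<in> B" "t = copy m1 s1" "x = f m1 (pos s1)"
      using nbr_line tu by blast
    obtain m2 s2 where 2: "m2 \<in> J" "s2 \<in> B" "u = copy m2 s2" "x = f m2 (pos s2)"
      using nbr_line tu by blast
    have M12: "m1 < M" "m2 < M" using 1 2 by (auto simp: J_def)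
    have "m1 \<noteq> m2"
    proof
      assume "m1 = m2"
      then have "pos s1 = pos s2" using f_eq_iff M12 bounds(1) 1 2 by metis
      then have "s1 = s2" using posB 1 2 by (auto simp: inj_on_def)
      then show False using 1 2 tu \<open>m1 = m2\<close> by simp
    qed
    moreover have "x \<in> e m1" using f_edge[OF M12(1)] bounds(1)[OF 1(2)] 1(4) by blast
    moreover have "x \<in> e m2" using f_edge[OF M12(2)] bounds(1)[OF 2(2)] 2(4) by blast
    ultimately show ?thesis using 1(1) 2(1) by metis
  qed
  have J0: "J \<noteq> {}"
  proof -
    obtain s where s: "s \<in> W" using W(3) by blast
    then consider x where "s = line x" | m u where "m < M" "u \<in> B" "s = copy m u"
      using W(1) unfolding lines_def copies_def by blast
    then show ?thesis
    proof cases
      case 1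
      then show ?thesis using line_two s by blast
    next
      case 2
      then show ?thesis using s by (auto simp: J_def)
    qed
  qed
  have finJ: "finite J" by (simp add: J_def)
  have "\<exists>h. \<forall>m\<in>J. \<exists>s\<in>B. h m = copy m s \<and> h m \<in> W"
    by (rule bchoice) (auto simp: J_def)
  then obtain h where h: "\<And>m. m \<in> J \<Longrightarrow> \<exists>s\<in>B. h m = copy m s \<and> h m \<in> W" by blast
  have "inj_on h J"
  proof (rule inj_onI)
    fix m m' assume m: "m \<in> J" "m' \<in> J" "h m = h m'"
    obtain s t where "s \<in> B" "h m = copy m s" "t \<in> B" "h m' = copy m' t" using h m by meson
    then show "m = m'" using m copy_eq_iff[of m m' s t] by (auto simp: J_def)
  qed
  then have "card J \<le> card W" by (rule card_inj_on_le) (use h W(2) in auto)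
  then have cJ: "card J < g" using W(4) by simp
  obtain m x where m: "m \<in> J" and x: "shared e J m \<subseteq> {x}"
    by (rule sparseD[OF sparse_e, of J]) (use finJ J0 cJ in \<open>auto simp: J_def\<close>)
  have mM: "m < M" using m by (simp add: J_def)
  define Wm where "Wm = {s \<in> B. copy m s \<in> W}"
  have WmB: "Wm \<subseteq> B" and finWm: "finite Wm" using finB by (auto simp: Wm_def)
  have "inj_on (copy m) Wm" using copy_eq_iff[OF mM mM] by (auto simp: inj_on_def Wm_def)
  then have "card Wm \<le> card W" by (rule card_inj_on_le) (use W(2) in \<open>auto simp: Wm_def\<close>)
  then have cWm: "card Wm < g" using W(4) by simp
  have Wm0: "Wm \<noteq> {}" using m by (auto simp: Wm_def J_def)
  \<comment> \<open>Inside \<open>W\<close>, a cell of copy \<open>m\<close> has only its own line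
    and cells of the same copy as neighbours. With at most one neighbour in the copy but two in
    \<open>W\<close>, it has its line and one further cell; the latter rules out a one-element
    \<open>Wm\<close>.\<close>
  have leaf: "line (f m (pos s)) \<in> W \<and> (\<exists>t\<in>Wm. t \<noteq> s)"
    if s: "s \<in> Wm" and l: "\<And>t u. \<lbrakk>t \<in> Wm; u \<in> Wm; t \<noteq> s; u \<noteq> s; touches s t; touches s u\<rbrakk> \<Longrightarrow> t = u" for s
  proof -
    have sB: "s \<in> B" "copy m s \<in> W" using s by (auto simp: Wm_def)
    have nbr: "w = line (f m (pos s)) \<or> (\<exists>t\<in>Wm. t \<noteq> s \<and> touches s t \<and> w = copy m t)"
      if w: "w \<in> W" "w \<noteq> copy m s" "touches (copy m s) w" for w
    proof -
      consider y where "w = line y" | n u where "n < M" "u \<in> B" "w = copy n u"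
        using w W(1) unfolding lines_def copies_def by blast
      then show ?thesis
      proof cases
        case 1
        then show ?thesis using w touches_sym touches_line_copy[OF mM sB(1)] by metis
      next
        case 2
        then have "m = n" "touches s u" using w touches_copies[OF mM 2(1) sB(1) 2(2)] by auto
        then show ?thesis using 2 w by (auto simp: Wm_def)
      qed
    qed
    obtain w w' where w: "w \<in> W" "w' \<in> W" "w \<noteq> copy m s" "w' \<noteq> copy m s" "w \<noteq> w'"
      "touches (copy m s) w" "touches (copy m s) w'" using two[OF sB(2)] by blast
    show ?thesis using nbr[OF w(1,3,6)] nbr[OF w(2,4,7)] w(1,2,5) l by metis
  qed
  have "\<exists>s\<in>Wm. \<exists>t\<in>Wm. s \<noteq> t \<and> (\<exists>x. shared star Wm s \<subseteq> {x}) \<and> (\<exists>y. shared star Wm t \<subseteq> {y})"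
  proof (cases "2 \<le> card Wm")
    case True
    then show ?thesis using two_leaves[OF sparseB finWm WmB cWm] by blast
  next
    case False
    have "0 < card Wm" using Wm0 finWm by (simp add: card_gt_0_iff)
    then have "card Wm = 1" using False by linarith
    then obtain s where "Wm = {s}" by (auto simp: card_1_singleton_iff)
    then show ?thesis using leaf[of s] by blast
  qed
  then obtain s t where st: "s \<in> Wm" "t \<in> Wm" "s \<noteq> t"
    "\<exists>x. shared star Wm s \<subseteq> {x}" "\<exists>x. shared star Wm t \<subseteq> {x}" by blast
  have ls: "line (f m (pos s)) \<in> W" using leaf[OF st(1)] st(4) unfolding shared_star by blast
  have lt: "line (f m (pos t)) \<in> W" using leaf[OF st(2)] st(5) unfolding shared_star by blast
  have sh: "f m (pos u) \<in> shared e J m" if "line (f m (pos u)) \<in> W" "u \<in> Wm" for u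
  proof -
    have "f m (pos u) \<in> e m" using f_edge[OF mM] bounds(1)[of u] that(2) WmB by blast
    then show ?thesis using line_two[OF that(1), of m] unfolding shared_def by blast
  qed
  have "f m (pos s) \<in> {x}" "f m (pos t) \<in> {x}"
    using sh[OF ls st(1)] sh[OF lt st(2)] x by (auto simp only: subset_iff)
  then have "f m (pos s) = f m (pos t)" by simp
  then have "pos s = pos t" using f_eq_iff[OF mM] bounds(1) st(1,2) WmB by (metis subsetD)
  then show False using posB st WmB by (auto simp: inj_on_def)
qed

text \<open>The lines colour the hypergraph vertices, and some edge \<open>e m\<close> becomes
  monochromatic of colour \<open>q\<close>. Either a cell of copy \<open>m\<close> also has colour
  \<open>q\<close> and clashes with its line, or copy \<open>m\<close> avoids \<open>q\<close> and
  is coloured with only \<open>k\<close> colours.\<close>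

lemma chromatic_step:
  assumes B: "chromatic_cells k B" and e: "ramsey (Suc k) {..<M} e"
  shows "chromatic_cells (Suc k) (lines \<union> copies)"
  unfolding chromatic_cells_def
proof (intro allI impI)
  fix c :: "cell \<Rightarrow> nat" assume c: "\<forall>s\<in>lines \<union> copies. c s < Suc k"
  \<comment> \<open>The default 0 is an admissible colour; the colour \<open>q\<close> is only read
    off at vertices \<open>f m (pos s)\<close>, which do own lines.\<close>
  define d where "d x = (if line x \<in> lines then c (line x) else 0)" for x
  have "\<forall>x. d x < Suc k" using c by (auto simp: d_def)
  then obtain m q where m: "m < M" "\<forall>x\<in>e m. d x = q"
    using e unfolding ramsey_def by blast
  have cp: "copy m s \<in> copies" "line (f m (pos s)) \<in> lines" "c (line (f m (pos s))) = q" if "s \<in> B" for s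
  proof -
    show "copy m s \<in> copies" using that m by (auto simp: copies_def)
    show l: "line (f m (pos s)) \<in> lines" using that m by (auto simp: lines_def)
    have "f m (pos s) \<in> e m" using f_edge[OF m(1)] bounds(1)[OF that] by blast
    then have "d (f m (pos s)) = q" using m(2) by blast
    then show "c (line (f m (pos s))) = q" using l by (simp add: d_def)
  qed
  show "\<exists>s\<in>lines \<union> copies. \<exists>t\<in>lines \<union> copies. s \<noteq> t \<and> touches s t \<and> c s = c t"
  proof (cases "\<exists>s\<in>B. c (copy m s) = q")
    case True
    then obtain s where s: "s \<in> B" "c (copy m s) = q" by blast
    have "touches (line (f m (pos s))) (copy m s)" using touches_line_copy[OF m(1) s(1)] by simp
    then show ?thesis using cp[OF s(1)] s(2) line_neq_copy[OF m(1)] by (metis UnI1 UnI2)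
  next
    case False
    \<comment> \<open>The colour \<open>k\<close> is renamed to the free colour \<open>q\<close>, so
      that the colours lie below \<open>k\<close>.\<close>
    define c' where "c' s = (if c (copy m s) = k then q else c (copy m s))" for s
    have ck: "c (copy m s) < Suc k \<and> c (copy m s) \<noteq> q \<and> q < Suc k" if "s \<in> B" for s
      using c cp[OF that] False that by (metis UnI1 UnI2)
    have "\<forall>s\<in>B. c' s < k"
      using ck unfolding c'_def by (metis less_SucE)
    then obtain s t where st: "s \<in> B" "t \<in> B" "s \<noteq> t" "touches s t" "c' s = c' t"
      using B unfolding chromatic_cells_def by blast
    have "c (copy m s) = c (copy m t)"
      using st(5) ck[OF st(1)] ck[OF st(2)] unfolding c'_def by (metis)
    moreover have "touches (copy m s) (copy m t)" using touches_copies[OF m(1) m(1)] st by simp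
    moreover have "copy m s \<noteq> copy m t" using copy_eq_iff[OF m(1) m(1)] st by simp
    ultimately show ?thesis using cp(1)[OF st(1)] cp(1)[OF st(2)] by blast
  qed
qed

end

section \<open>Iterating the construction\<close>

lemma sparse_chromatic_cells:
  "\<exists>B. finite B \<and> inj_on pos B \<and> (\<forall>s\<in>B. valid s) \<and> sparse g B star \<and> chromatic_cells k B"
proof (induction k)
  case 0
  let ?s = "Cell 0 0 0 0 0"
  have "sparse g {?s} star"
    unfolding sparse_def
  proof (intro allI impI)
    fix J assume "J \<subseteq> {?s}" "J \<noteq> {}"
    then have "J = {?s}" by blast
    then show "\<exists>i\<in>J. \<exists>x. shared star J i \<subseteq> {x}" by (simp add: shared_def)
  qed
  then show ?case by (intro exI[of _ "{?s}"]) (simp add: valid_def chromatic_cells_def)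
next
  case (Suc k)
  then obtain B where B: "finite B" "inj_on pos B" "\<And>s. s \<in> B \<Longrightarrow> valid s" "sparse g B star"
    "chromatic_cells k B" by blast
  \<comment> \<open>Strict bounds on the coordinates of \<open>B\<close>; inserting 0 keeps
    \<open>Max\<close> meaningful for an empty set.\<close>
  define K where "K = Suc (Max (insert 0 (right ` B)))"
  define Z where "Z = Suc (Max (insert 0 (top ` B)))"
  have K: "right s < K" if "s \<in> B" for s using that B(1) by (simp add: K_def less_Suc_eq_le)
  have Z: "top s < Z" if "s \<in> B" for s using that B(1) by (simp add: Z_def less_Suc_eq_le)
  obtain I :: "nat set" and e :: "nat \<Rightarrow> nat set" where e: "finite I"
    "\<forall>j\<in>I. finite (e j) \<and> card (e j) = K" "sparse g I e" "ramsey (Suc k) I e"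
    using sparse_ramsey_hypergraph[of K g "Suc k"] by blast
  define M where "M = card I"
  obtain b where b: "bij_betw b {..<M} I"
    using ex_bij_betw_nat_finite[OF e(1)] unfolding M_def atLeast0LessThan by blast
  define e' where "e' m = e (b m)" for m
  have bI: "b m \<in> I" if "m < M" for m using b that by (auto simp: bij_betw_def)
  have "\<exists>h. bij_betw h {..<K} (e' m) \<and> strict_mono_on {..<K} h" if "m < M" for m
    using ex_bij_betw_strict_mono_card[of "e' m"] e(2) bI[OF that] by (metis e'_def)
  then obtain f where f: "\<And>m. m < M \<Longrightarrow> bij_betw (f m) {..<K} (e' m) \<and> strict_mono_on {..<K} (f m)"
    by metis
  have ram: "ramsey (Suc k) {..<M} e'"
    unfolding ramsey_def
  proof (intro allI impI)
    fix c :: "nat \<Rightarrow> nat" assume "\<forall>x. c x < Suc k"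
    then obtain i q where i: "i \<in> I" "\<forall>x\<in>e i. c x = q" using e(4) unfolding ramsey_def by blast
    then obtain m where "m < M" "i = b m" using b by (auto simp: bij_betw_def)
    then show "\<exists>i\<in>{..<M}. \<exists>q. \<forall>x\<in>e' i. c x = q" using i by (auto simp: e'_def)
  qed
  have sp: "sparse g {..<M} e'"
    unfolding sparse_def
  proof (intro allI impI)
    fix J assume J: "J \<subseteq> {..<M}" "finite J" "J \<noteq> {}" "card J < g"
    have inj: "inj_on b J" using b J(1) inj_on_subset by (auto simp: bij_betw_def)
    have "b ` J \<subseteq> I" using bI J(1) by blast
    then obtain i x where i: "i \<in> b ` J" "shared e (b ` J) i \<subseteq> {x}"
      by (rule sparseD[OF e(3)]) (use J inj in \<open>auto simp: card_image\<close>)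
    then obtain m where m: "m \<in> J" "i = b m" by blast
    then have "b ` J - {i} = b ` (J - {m})" using inj by (auto simp: inj_on_def)
    then have "shared e' J m \<subseteq> {x}" using i m by (simp add: shared_def e'_def)
    then show "\<exists>i\<in>J. \<exists>x. shared e' J i \<subseteq> {x}" using m by blast
  qed
  interpret descartes g k K M Z B e' f
    by unfold_locales (use B K Z sp f in \<open>auto simp: bij_betw_def\<close>)
  show ?case
    using finite_cells inj_pos valid_cells sparse_cells chromatic_step[OF B(5) ram] by blast
qed

section \<open>Boxes\<close>

definition box_of :: "cell \<Rightarrow> (real ^ 3) set" where
  "box_of s = cbox (vector [real (pos s), real (low s), real (bot s)])
                   (vector [real (right s), real (pos s), real (top s)])"

lemma mem_box_of:
  "x \<in> box_of s \<longleftrightarrow> real (pos s) \<le> x $ 1 \<and> x $ 1 \<le> real (right s) \<and>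
     real (low s) \<le> x $ 2 \<and> x $ 2 \<le> real (pos s) \<and> real (bot s) \<le> x $ 3 \<and> x $ 3 \<le> real (top s)"
  by (auto simp: box_of_def mem_box_cart forall_3 vector_3)

lemma box_of_meet:
  assumes "valid s" "valid t"
  shows "box_of s \<inter> box_of t \<noteq> {} \<longleftrightarrow> touches s t"
proof
  assume "box_of s \<inter> box_of t \<noteq> {}"
  then obtain x where "x \<in> box_of s" "x \<in> box_of t" by blast
  then have "real (pos s) \<le> real (right t)" "real (pos t) \<le> real (right s)"
    "real (low s) \<le> real (pos t)" "real (low t) \<le> real (pos s)"
    "real (bot s) \<le> real (top t)" "real (bot t) \<le> real (top s)"
    unfolding mem_box_of by linarith+
  then show "touches s t" by (simp add: touches_def)
next
  assume "touches s t"
  \<comment> \<open>The common point is the componentwise maximum of the lower corners.\<close>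
  then have "vector [real (max (pos s) (pos t)), real (max (low s) (low t)), real (max (bot s) (bot t))]
      \<in> box_of s \<inter> box_of t"
    using assms by (simp add: mem_box_of vector_3 touches_def valid_def)
  then show "box_of s \<inter> box_of t \<noteq> {}" by blast
qed

text \<open>\<open>pos\<close> is the least first coordinate in the box. As positions are distinct,
  passing from cells to a set of boxes merges no two vertices.\<close>

lemma box_of_eq_imp_pos:
  assumes "valid s" "valid t" "box_of s = box_of t"
  shows "pos s = pos t"
proof -
  have *: "pos v \<le> pos u" if "valid u" "box_of u = box_of v" for u v
  proof -
    have "vector [real (pos u), real (low u), real (bot u)] \<in> box_of u"
      using that(1) by (simp add: mem_box_of vector_3 valid_def)
    then show ?thesis unfolding that(2) by (simp add: mem_box_of vector_3)
  qed
  show ?thesis using *[of s t] *[of t s] assms by simp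
qed

lemma axis_aligned_box_of: "valid s \<Longrightarrow> axis_aligned_box (box_of s)"
  unfolding axis_aligned_box_def box_of_def
  by (intro exI conjI) (auto simp: forall_3 vector_3 valid_def)

text \<open>The boxes on a cycle shorter than \<open>g\<close> would form a small set of cells in
  which each has two neighbours, against sparsity; a proper colouring with fewer than
  \<open>k\<close> colours would contradict \<open>chromatic_cells k\<close>.\<close>

theorem theorem1:
  fixes g k :: nat
  assumes "g \<ge> 3" and "k \<ge> 1"
  shows "\<exists>\<B> :: (real ^ 3) set set.
           finite \<B> \<and> (\<forall>B \<in> \<B>. axis_aligned_box B) \<and>
           girth (intersection_graph \<B>) \<ge> enat g \<and>
           chromatic_number (intersection_graph \<B>) \<ge> enat k"
proof -
  obtain C where C: "finite C" "inj_on pos C" "\<And>s. s \<in> C \<Longrightarrow> valid s" "sparse g C star"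
    "chromatic_cells k C" using sparse_chromatic_cells[of g k] by blast
  let ?G = "intersection_graph (box_of ` C)"
  have inj: "inj_on box_of C"
    using C(2,3) box_of_eq_imp_pos by (meson inj_on_def)
  have edge: "{box_of s, box_of t} \<in> edges ?G \<longleftrightarrow> s \<noteq> t \<and> touches s t" if "s \<in> C" "t \<in> C" for s t
  proof -
    have "{box_of s, box_of t} \<in> edges ?G \<longleftrightarrow> box_of s \<noteq> box_of t \<and> box_of s \<inter> box_of t \<noteq> {}"
      using that by (auto simp: intersection_graph_def doubleton_eq_iff)
    then show ?thesis using that C(3) box_of_meet inj by (auto simp: inj_on_def)
  qed
  have "enat g \<le> enat (length p)" if p: "is_cycle ?G p" for p
  proof (rule ccontr)
    assume "\<not> enat g \<le> enat (length p)"
    then have short: "length p < g" by simp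
    have p3: "3 \<le> length p" and dist: "distinct p" and sub: "set p \<subseteq> box_of ` C"
      and step: "\<And>i. i < length p \<Longrightarrow> {p ! i, p ! (Suc i mod length p)} \<in> edges ?G"
      using p by (auto simp: is_cycle_def intersection_graph_def)
    define W where "W = {s \<in> C. box_of s \<in> set p}"
    have imW: "box_of ` W = set p" using sub by (auto simp: W_def)
    have WC: "W \<subseteq> C" by (auto simp: W_def)
    have cW: "card W = length p"
      using card_image[OF inj_on_subset[OF inj WC]] imW distinct_card[OF dist] by simp
    have finW: "finite W" using C(1) WC finite_subset by blast
    have W0: "W \<noteq> {}" using cW p3 by auto
    obtain s x where s: "s \<in> W" "shared star W s \<subseteq> {x}"
      by (rule sparseD[OF C(4) WC finW W0]) (use cW short in auto)
    then have one: "\<And>t u. \<lbrakk>t \<in> W; u \<in> W; t \<noteq> s \<and> touches s t; u \<noteq> s \<and> touches s u\<rbrakk> \<Longrightarrow> t = u"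
      using shared_star[of W s] by blast
    let ?n = "length p"
    obtain i where i: "i < ?n" "p ! i = box_of s"
      using s imW by (metis image_eqI in_set_conv_nth)
    \<comment> \<open>Successor and predecessor of the leaf on the cycle; they are different because
      the cycle has length at least 3.\<close>
    define j where "j = Suc i mod ?n"
    define l where "l = (if i = 0 then ?n - 1 else i - 1)"
    have jl: "j < ?n" "l < ?n" "Suc l mod ?n = i" "j \<noteq> l" "j \<noteq> i" "l \<noteq> i"
    proof -
      show "j < ?n" using p3 unfolding j_def by (intro mod_less_divisor) linarith
      show "l < ?n" "l \<noteq> i" using p3 i by (auto simp: l_def)
      show "Suc l mod ?n = i" using p3 i by (auto simp: l_def)
      have "j = (if Suc i = ?n then 0 else Suc i)" using i by (auto simp: j_def)
      then show "j \<noteq> l" "j \<noteq> i" using p3 i by (auto simp: l_def)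
    qed
    obtain t where t: "t \<in> W" "p ! j = box_of t" using jl imW by (metis imageE nth_mem)
    obtain u where u: "u \<in> W" "p ! l = box_of u" using jl imW by (metis imageE nth_mem)
    have "{box_of s, box_of t} \<in> edges ?G" using step[OF i(1)] i(2) t(2) by (simp add: j_def)
    then have "t \<noteq> s \<and> touches s t" using edge s t WC by blast
    moreover have "{box_of s, box_of u} \<in> edges ?G"
      using step[OF jl(2)] jl(3) i(2) u(2) by (simp add: insert_commute)
    then have "u \<noteq> s \<and> touches s u" using edge s u WC by blast
    ultimately have "t = u" using one t u by blast
    then have "p ! j = p ! l" using t u by simp
    then show False using jl dist by (simp add: nth_eq_iff_index_eq)
  qed
  then have "enat g \<le> girth ?G" unfolding girth_def by (intro INF_greatest) blast
  moreover have "enat k \<le> enat n" if col: "proper_colouring ?G n c" for n c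
  proof (rule ccontr)
    assume "\<not> enat k \<le> enat n"
    then have "n < k" by simp
    moreover have "c (box_of s) < n" if "s \<in> C" for s
      using col that by (auto simp: proper_colouring_def intersection_graph_def)
    ultimately have "\<forall>s\<in>C. c (box_of s) < k" by (meson less_trans)
    then obtain s t where st: "s \<in> C" "t \<in> C" "s \<noteq> t" "touches s t" "c (box_of s) = c (box_of t)"
      using C(5)[unfolded chromatic_cells_def, rule_format, of "\<lambda>s. c (box_of s)"] by blast
    then have "{box_of s, box_of t} \<in> edges ?G" using edge by blast
    moreover have "box_of s \<in> verts ?G" "box_of t \<in> verts ?G"
      using st by (auto simp: intersection_graph_def)
    ultimately show False using col st(5) unfolding proper_colouring_def by blast
  qed
  then have "enat k \<le> chromatic_number ?G" unfolding chromatic_number_def by (intro INF_greatest) blast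
  ultimately show ?thesis
    using C(1,3) axis_aligned_box_of by (intro exI[of _ "box_of ` C"]) auto
qed

end
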